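(* Let $\hat g=D_n^{(1)}$, $0\le p<n$ and $N\ge1$. Then the transfer matrix has the "left" $Z_2$ symmetry $$[\mathcal Z^{(l)},t(u,p)]=0,$$ where $\mathcal Z^{(l)}=Z_1^{(l)}Z_2^{(l)}\cdots Z_N^{(l)}$ (so $(\mathcal Z^{(l)})^2=\mathbb I^{\otimes N}$) and $Z^{(l)}$ is the $2n\times2n$ block-diagonal matrix $$Z^{(l)}=\begin{pmatrix}\mathbb I_{(n-1)\times(n-1)}&&&\\&0&1&\\&1&0&\\&&&\mathbb I_{(n-1)\times(n-1)}\end{pmatrix}.$$
   Context: **R-matrix of type $D_n^{(1)}$.** Fix $n\ge1$, $\eta\in\mathbb C$, $d=2n$, $\mathcal V=\mathbb C^{2n}$, $e_{ij}$ the elementary $2n\times2n$ matrices, $\mathbb I$ the identity on $\mathcal V$. Let $\kappa=2n-2$, $\alpha'=2n+1-\alpha$, $\bar\alpha=\alpha+\frac12$ if $\alpha\le n$ and $\bar\alpha=\alpha-\frac12$ if $\alpha\ge n+1$. Let $$c(u)=2\sinh(\tfrac u2-2\eta)\sinh(\tfrac u2-\kappa\eta),\ b(u)=2\sinh(\tfrac u2)\sinh(\tfrac u2-\kappa\eta),\ e(u)=-2e^{-u/2}\sinh(2\eta)\sinh(\tfrac u2-\kappa\eta),\ \bar e(u)=e^ue(u),$$ $a_{\alpha\alpha}(u)=2\sinh(\frac u2)\sinh(\frac u2-(\kappa-2)\eta)$, and, with upper signs for $\alpha<\beta$ and lower signs for $\alpha>\beta$, $a_{\alpha\beta}(u)=2\sinh(2\eta)e^{\mp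 u/2}[e^{(\pm\kappa+2(\bar\alpha-\bar\beta))\eta}\sinh(\frac u2)-\delta_{\alpha\beta'}\sinh(\frac u2-\kappa\eta)]$. Then $$R(u)=c(u)\sum_{\alpha}e_{\alpha\alpha}\otimes e_{\alpha\alpha}+b(u)\sum_{\alpha\neq\beta,\beta'}e_{\alpha\alpha}\otimes e_{\beta\beta}+\Big(e(u)\sum_{\alpha<\beta,\alpha\ne\beta'}+\bar e(u)\sum_{\alpha>\beta,\alpha\ne\beta'}\Big)e_{\alpha\beta}\otimes e_{\beta\alpha}+\sum_{\alpha,\beta}a_{\alpha\beta}(u)e_{\alpha\beta}\otimes e_{\alpha'\beta'}.$$ Subscripts on operators indicate the tensor factors on which they act; $R_{21}=\mathcal PR_{12}\mathcal P$ with $\mathcal P$ the permutation. **K-matrices.** $\rho=-2\kappa\eta$; fix $\gamma_0\in\{1,-1\}$; $\gamma=\gamma_0e^{(4p-2)\eta+\rho/2}$. $K^R(u,p)$ is diagonal with first $p$ entries $e^{-u}$, middle $2n-2p$ entries $\frac{\gamma e^u+1}{\gamma+e^u}$, last $p$ entries $e^u$. $M=\sum_\alpha e^{4(\frac{2n+1}2-\bar\alpha)\eta}e_{\alpha\alpha}$; $K^L(u,p)=K^R(-u-\rho,p)M$. Identities in $u$ are understood as identities of meromorphic functions. **Transfer matrix** (on $\mathcal V^{\otimes N}$, $a$ an auxiliary copy of $\mathcal V$): $t(u,p)=\operatorname{tr}_aK^L_a(u,p)T_a(u)K^R_a(u,p)\widehat T_a(u)$, $T_a(u)=R_{aN}(u)\cdots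 R_{a1}(u)$, $\widehat T_a(u)=R_{1a}(u)\cdots R_{Na}(u)$. *)

theory Defs
  imports Complex_Main "Jordan_Normal_Form.Matrix"
begin

text \<open>
  Labels \<open>\<alpha>\<close>, \<open>\<beta>\<close> of basis vectors of \<open>V = \<complex>\<^sup>d\<close>, \<open>d = 2n\<close>, run over \<open>1, ..., d\<close>, whereas matrix
  entries are indexed from \<open>0\<close>.  An operator on an \<open>L\<close>-fold tensor power of \<open>V\<close> is a
  \<open>d^L \<times> d^L\<close> matrix in the lexicographically ordered product basis (leftmost factor most
  significant).
\<close>

definition kron :: "complex mat \<Rightarrow> complex mat \<Rightarrow> complex mat" where
  "kron A B = mat (dim_row A * dim_row B) (dim_col A * dim_col B)
     (\<lambda>(i, j). A $$ (i div dim_row B, j div dim_col B) * B $$ (i mod dim_row B, j mod dim_col B))"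

text \<open>Matrices of varying dimension do not form a type class of monoids, so finite sums of
  \<open>m \<times> m\<close> matrices are taken entrywise.\<close>

definition msum :: "nat \<Rightarrow> ('i \<Rightarrow> complex mat) \<Rightarrow> 'i set \<Rightarrow> complex mat" where
  "msum m F S = mat m m (\<lambda>(i, j). \<Sum>s\<in>S. F s $$ (i, j))"

text \<open>The list \<open>[A1, ..., Ak]\<close> is multiplied in the order \<open>A1 * ... * Ak\<close>.\<close>

definition mprod :: "nat \<Rightarrow> complex mat list \<Rightarrow> complex mat" where
  "mprod m As = foldr (*) As (1\<^sub>m m)"

definition elem_mat :: "nat \<Rightarrow> nat \<Rightarrow> nat \<Rightarrow> complex mat" where
  "elem_mat d \<alpha> \<beta> = mat d d (\<lambda>(i, j). if i + 1 = \<alpha> \<and> j + 1 = \<beta> then 1 else 0)"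

text \<open>\<open>on1 d L k X\<close> acts as \<open>X\<close> on the factor with \<open>k\<close> factors to its left (\<open>k < L\<close>), and as the
  identity on the other factors.\<close>

definition on1 :: "nat \<Rightarrow> nat \<Rightarrow> nat \<Rightarrow> complex mat \<Rightarrow> complex mat" where
  "on1 d L k X = kron (1\<^sub>m (d ^ k)) (kron X (1\<^sub>m (d ^ (L - 1 - k))))"

text \<open>\<open>on2 d L k l X\<close> for \<open>k \<noteq> l\<close>: expand \<open>X\<close> on \<open>V \<otimes> V\<close> in the elementary tensors
  \<open>e\<^sub>\<alpha>\<^sub>\<beta> \<otimes> e\<^sub>\<mu>\<^sub>\<nu>\<close> and let the first leg act on factor \<open>k\<close>, the second on factor \<open>l\<close>.\<close>

definition on2 :: "nat \<Rightarrow> nat \<Rightarrow> nat \<Rightarrow> nat \<Rightarrow> complex mat \<Rightarrow> complex mat" where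
  "on2 d L k l X = msum (d ^ L)
     (\<lambda>(\<alpha>, \<beta>, \<mu>, \<nu>). X $$ ((\<alpha> - 1) * d + (\<mu> - 1), (\<beta> - 1) * d + (\<nu> - 1)) \<cdot>\<^sub>m
        (on1 d L k (elem_mat d \<alpha> \<beta>) * on1 d L l (elem_mat d \<mu> \<nu>)))
     ({1..d} \<times> {1..d} \<times> {1..d} \<times> {1..d})"

text \<open>Trace over the leftmost factor \<open>V\<close> of \<open>V \<otimes> W\<close>, where \<open>W\<close> has dimension \<open>m\<close>.\<close>

definition trace_first :: "nat \<Rightarrow> nat \<Rightarrow> complex mat \<Rightarrow> complex mat" where
  "trace_first d m A = mat m m (\<lambda>(i, j). \<Sum>k<d. A $$ (k * m + i, k * m + j))"

definition perm_mat :: "nat \<Rightarrow> complex mat" where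
  "perm_mat d = msum (d * d) (\<lambda>(\<alpha>, \<beta>). kron (elem_mat d \<alpha> \<beta>) (elem_mat d \<beta> \<alpha>))
     ({1..d} \<times> {1..d})"

text \<open>\<open>R_mat\<close> is the trigonometric R-matrix of type $D_n^{(1)}$ with $\kappa = 2n - 2$; \<open>dual n \<alpha>\<close> is $\alpha'$.\<close>

definition kappa :: "nat \<Rightarrow> complex" where
  "kappa n = 2 * of_nat n - 2"

definition dual :: "nat \<Rightarrow> nat \<Rightarrow> nat" where
  "dual n \<alpha> = 2 * n + 1 - \<alpha>"

definition bar :: "nat \<Rightarrow> nat \<Rightarrow> complex" where
  "bar n \<alpha> = (if \<alpha> \<le> n then of_nat \<alpha> + 1 / 2 else of_nat \<alpha> - 1 / 2)"

definition c_coeff :: "nat \<Rightarrow> complex \<Rightarrow> complex \<Rightarrow> complex" where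
  "c_coeff n \<eta> u = 2 * sinh (u / 2 - 2 * \<eta>) * sinh (u / 2 - kappa n * \<eta>)"

definition b_coeff :: "nat \<Rightarrow> complex \<Rightarrow> complex \<Rightarrow> complex" where
  "b_coeff n \<eta> u = 2 * sinh (u / 2) * sinh (u / 2 - kappa n * \<eta>)"

definition e_coeff :: "nat \<Rightarrow> complex \<Rightarrow> complex \<Rightarrow> complex" where
  "e_coeff n \<eta> u = - 2 * exp (- u / 2) * sinh (2 * \<eta>) * sinh (u / 2 - kappa n * \<eta>)"

definition ebar_coeff :: "nat \<Rightarrow> complex \<Rightarrow> complex \<Rightarrow> complex" where
  "ebar_coeff n \<eta> u = exp u * e_coeff n \<eta> u"

text \<open>\<open>s = 1\<close> gives the upper signs, \<open>s = -1\<close> the lower ones.\<close>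

definition a_coeff :: "nat \<Rightarrow> complex \<Rightarrow> complex \<Rightarrow> nat \<Rightarrow> nat \<Rightarrow> complex" where
  "a_coeff n \<eta> u \<alpha> \<beta> =
     (if \<alpha> = \<beta> then 2 * sinh (u / 2) * sinh (u / 2 - (kappa n - 2) * \<eta>)
      else let s = (if \<alpha> < \<beta> then 1 else - 1) in
        2 * sinh (2 * \<eta>) * exp (- s * u / 2) *
          (exp ((s * kappa n + 2 * (bar n \<alpha> - bar n \<beta>)) * \<eta>) * sinh (u / 2)
           - (if \<alpha> = dual n \<beta> then sinh (u / 2 - kappa n * \<eta>) else 0)))"

definition R_mat :: "nat \<Rightarrow> complex \<Rightarrow> complex \<Rightarrow> complex mat" where
  "R_mat n \<eta> u = (let d = 2 * n; I = {1..d}; e = elem_mat d in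
      c_coeff n \<eta> u \<cdot>\<^sub>m msum (d * d) (\<lambda>\<alpha>. kron (e \<alpha> \<alpha>) (e \<alpha> \<alpha>)) I
    + b_coeff n \<eta> u \<cdot>\<^sub>m msum (d * d) (\<lambda>(\<alpha>, \<beta>). kron (e \<alpha> \<alpha>) (e \<beta> \<beta>))
        {(\<alpha>, \<beta>) \<in> I \<times> I. \<alpha> \<noteq> \<beta> \<and> \<alpha> \<noteq> dual n \<beta>}
    + e_coeff n \<eta> u \<cdot>\<^sub>m msum (d * d) (\<lambda>(\<alpha>, \<beta>). kron (e \<alpha> \<beta>) (e \<beta> \<alpha>))
        {(\<alpha>, \<beta>) \<in> I \<times> I. \<alpha> < \<beta> \<and> \<alpha> \<noteq> dual n \<beta>}
    + ebar_coeff n \<eta> u \<cdot>\<^sub>m msum (d * d) (\<lambda>(\<alpha>, \<beta>). kron (e \<alpha> \<beta>) (e \<beta> \<alpha>))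
        {(\<alpha>, \<beta>) \<in> I \<times> I. \<alpha> > \<beta> \<and> \<alpha> \<noteq> dual n \<beta>}
    + msum (d * d)
        (\<lambda>(\<alpha>, \<beta>). a_coeff n \<eta> u \<alpha> \<beta> \<cdot>\<^sub>m kron (e \<alpha> \<beta>) (e (dual n \<alpha>) (dual n \<beta>)))
        (I \<times> I))"

definition rho :: "nat \<Rightarrow> complex \<Rightarrow> complex" where
  "rho n \<eta> = - 2 * kappa n * \<eta>"

definition gam :: "nat \<Rightarrow> complex \<Rightarrow> complex \<Rightarrow> nat \<Rightarrow> complex" where
  "gam n \<eta> \<gamma>0 p = \<gamma>0 * exp ((4 * of_nat p - 2) * \<eta> + rho n \<eta> / 2)"

definition KR :: "nat \<Rightarrow> complex \<Rightarrow> complex \<Rightarrow> nat \<Rightarrow> complex \<Rightarrow> complex mat" where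
  "KR n \<eta> \<gamma>0 p u = mat (2 * n) (2 * n) (\<lambda>(i, j).
     if i \<noteq> j then 0
     else if i < p then exp (- u)
     else if i < 2 * n - p
       then (gam n \<eta> \<gamma>0 p * exp u + 1) / (gam n \<eta> \<gamma>0 p + exp u)
     else exp u)"

definition M_mat :: "nat \<Rightarrow> complex \<Rightarrow> complex mat" where
  "M_mat n \<eta> = msum (2 * n)
     (\<lambda>\<alpha>. exp (4 * ((2 * of_nat n + 1) / 2 - bar n \<alpha>) * \<eta>) \<cdot>\<^sub>m elem_mat (2 * n) \<alpha> \<alpha>) {1..2 * n}"

definition KL :: "nat \<Rightarrow> complex \<Rightarrow> complex \<Rightarrow> nat \<Rightarrow> complex \<Rightarrow> complex mat" where
  "KL n \<eta> \<gamma>0 p u = KR n \<eta> \<gamma>0 p (- u - rho n \<eta>) * M_mat n \<eta>"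

text \<open>The points \<open>u\<close> at which no denominator in \<open>K\<^sup>R(u,p)\<close> or \<open>K\<^sup>L(u,p)\<close> vanishes; the complement
  is closed and discrete, since \<open>\<gamma> \<noteq> 0\<close>.\<close>

definition K_regular :: "nat \<Rightarrow> complex \<Rightarrow> complex \<Rightarrow> nat \<Rightarrow> complex \<Rightarrow> bool" where
  "K_regular n \<eta> \<gamma>0 p u \<longleftrightarrow>
     gam n \<eta> \<gamma>0 p + exp u \<noteq> 0 \<and> gam n \<eta> \<gamma>0 p + exp (- u - rho n \<eta>) \<noteq> 0"

text \<open>On \<open>V\<^sub>a \<otimes> V\<^sub>1 \<otimes> ... \<otimes> V\<^sub>N\<close> the auxiliary space \<open>a\<close> is factor \<open>0\<close> and site \<open>k\<close> is
  factor \<open>k\<close>.\<close>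

definition R_ak :: "nat \<Rightarrow> complex \<Rightarrow> nat \<Rightarrow> nat \<Rightarrow> complex \<Rightarrow> complex mat" where
  "R_ak n \<eta> N k u = on2 (2 * n) (N + 1) 0 k (R_mat n \<eta> u)"

definition R_ka :: "nat \<Rightarrow> complex \<Rightarrow> nat \<Rightarrow> nat \<Rightarrow> complex \<Rightarrow> complex mat" where
  "R_ka n \<eta> N k u =
     on2 (2 * n) (N + 1) 0 k (perm_mat (2 * n) * R_mat n \<eta> u * perm_mat (2 * n))"

definition T_mat :: "nat \<Rightarrow> complex \<Rightarrow> nat \<Rightarrow> complex \<Rightarrow> complex mat" where
  "T_mat n \<eta> N u = mprod ((2 * n) ^ (N + 1)) (map (\<lambda>k. R_ak n \<eta> N k u) (rev [1..<N + 1]))"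

definition T_hat :: "nat \<Rightarrow> complex \<Rightarrow> nat \<Rightarrow> complex \<Rightarrow> complex mat" where
  "T_hat n \<eta> N u = mprod ((2 * n) ^ (N + 1)) (map (\<lambda>k. R_ka n \<eta> N k u) [1..<N + 1])"

definition transfer_mat ::
  "nat \<Rightarrow> complex \<Rightarrow> complex \<Rightarrow> nat \<Rightarrow> nat \<Rightarrow> complex \<Rightarrow> complex mat" where
  "transfer_mat n \<eta> \<gamma>0 N p u = trace_first (2 * n) ((2 * n) ^ N)
     (on1 (2 * n) (N + 1) 0 (KL n \<eta> \<gamma>0 p u) * T_mat n \<eta> N u *
      on1 (2 * n) (N + 1) 0 (KR n \<eta> \<gamma>0 p u) * T_hat n \<eta> N u)"

definition Z_left :: "nat \<Rightarrow> complex mat" where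
  "Z_left n = diag_block_mat [1\<^sub>m (n - 1), mat_of_rows_list 2 [[0, 1], [1, 0]], 1\<^sub>m (n - 1)]"

text \<open>Without the auxiliary space, site \<open>k\<close> is factor \<open>k - 1\<close> of the \<open>N\<close>-fold tensor power.\<close>

definition Z_left_total :: "nat \<Rightarrow> nat \<Rightarrow> complex mat" where
  "Z_left_total n N = mprod ((2 * n) ^ N) (map (\<lambda>k. on1 (2 * n) N (k - 1) (Z_left n)) [1..<N + 1])"

end

theory Submission
  imports Defs "HOL-Combinatorics.Transposition"
begin

text \<open>
  The labels \<open>n\<close> and \<open>n + 1\<close> are dual to each other and have the same \<open>bar\<close> value, and
  \<open>Z\<close> is the matrix of the permutation exchanging them.  Since also
  \<open>a_coeff n \<eta> u n (n + 1) = a_coeff n \<eta> u (n + 1) n\<close>, every coefficient of the R-matrix is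
  invariant under this exchange, so \<open>R\<close> commutes with \<open>Z \<otimes> Z\<close>; for \<open>p < n\<close> the diagonal K-matrices
  commute with \<open>Z\<close>.  Hence the operator under the trace commutes with \<open>Z \<otimes> Z \<otimes> \<dots> \<otimes> Z\<close>, and the
  auxiliary factor \<open>Z\<close> is cancelled by cyclicity of the partial trace and \<open>Z * Z = 1\<close>.
\<close>

section \<open>Kronecker products\<close>

lemma mod_less_of_less_mult: "i < a * b \<Longrightarrow> i mod b < b" for i a b :: nat
  by (cases b) auto

lemma pair_less:
  fixes k j a b :: nat
  assumes "k < a" "j < b"
  shows "k * b + j < a * b"
proof -
  have "k * b + j < Suc k * b" using assms(2) by simp
  also have "\<dots> \<le> a * b" using assms(1) by (intro mult_le_mono1) simp
  finally show ?thesis .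
qed

text \<open>Division with remainder, \<open>l = k * b + j\<close>, identifies an index of the
  lexicographic product basis with a pair of indices of the two factors. If \<open>b = 0\<close>,
  both sides are empty sums.\<close>

lemma sum_lessThan_mult:
  fixes f :: "nat \<Rightarrow> nat \<Rightarrow> 'a::comm_monoid_add"
  shows "(\<Sum>l<a * b. f (l div b) (l mod b)) = (\<Sum>k<a. \<Sum>j<b. f k j)"
proof -
  have "(\<Sum>l<a * b. f (l div b) (l mod b)) = (\<Sum>(k, j)\<in>{..<a} \<times> {..<b}. f k j)"
  proof (rule sum.reindex_bij_witness[where i = "\<lambda>(k, j). k * b + j" and j = "\<lambda>l. (l div b, l mod b)"])
    fix l assume "l \<in> {..<a * b}"
    then have "l < a * b" by simp
    from less_mult_imp_div_less[OF this] mod_less_of_less_mult[OF this]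
    show "(l div b, l mod b) \<in> {..<a} \<times> {..<b}" by simp
  next
    fix kj assume kj: "kj \<in> {..<a} \<times> {..<b}"
    then show "(case kj of (k, j) \<Rightarrow> k * b + j) \<in> {..<a * b}"
      by (cases kj) (simp add: pair_less)
    show "((case kj of (k, j) \<Rightarrow> k * b + j) div b, (case kj of (k, j) \<Rightarrow> k * b + j) mod b) = kj"
      using kj by (cases kj) simp
  qed simp_all
  then show ?thesis by (simp add: sum.cartesian_product)
qed

lemma dim_kron [simp]:
  "dim_row (kron A B) = dim_row A * dim_row B" "dim_col (kron A B) = dim_col A * dim_col B"
  by (simp_all add: kron_def)

lemma index_kron:
  "i < dim_row A * dim_row B \<Longrightarrow> j < dim_col A * dim_col B \<Longrightarrow>
     kron A B $$ (i, j) = A $$ (i div dim_row B, j div dim_col B) * B $$ (i mod dim_row B, j mod dim_col B)"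
  by (simp add: kron_def)

lemma kron_carrier [simp]:
  "A \<in> carrier_mat a b \<Longrightarrow> B \<in> carrier_mat c d \<Longrightarrow> kron A B \<in> carrier_mat (a * c) (b * d)"
  by (rule carrier_matI) simp_all

lemma div_eq_mod_eq_imp_eq: "i div b = j div b \<Longrightarrow> i mod b = j mod b \<Longrightarrow> i = j" for i j b :: nat
  by (metis div_mult_mod_eq)

text \<open>The mixed product rule. The inner index runs over pairs, and each summand is a term in
  \<open>k\<close> times a term in \<open>k'\<close>, so the double sum factors into two matrix
  products.\<close>

lemma kron_mult:
  assumes "dim_col A = dim_row C" "dim_col B = dim_row D"
  shows "kron A B * kron C D = kron (A * C) (B * D)"
proof (rule eq_matI)
  fix i j
  assume "i < dim_row (kron (A * C) (B * D))" "j < dim_col (kron (A * C) (B * D))"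
  then have ij: "i < dim_row A * dim_row B" "j < dim_col C * dim_col D" by simp_all
  note b = less_mult_imp_div_less[OF ij(1)] less_mult_imp_div_less[OF ij(2)]
    mod_less_of_less_mult[OF ij(1)] mod_less_of_less_mult[OF ij(2)]
  have "(kron A B * kron C D) $$ (i, j) = (\<Sum>l<dim_row C * dim_row D. kron A B $$ (i, l) * kron C D $$ (l, j))"
    using ij assms by (simp add: scalar_prod_def atLeast0LessThan)
  also have "\<dots> = (\<Sum>l<dim_row C * dim_row D.
      (\<lambda>k k'. A $$ (i div dim_row B, k) * B $$ (i mod dim_row B, k') *
        (C $$ (k, j div dim_col D) * D $$ (k', j mod dim_col D))) (l div dim_row D) (l mod dim_row D))"
    using ij assms by (intro sum.cong) (auto simp: index_kron)
  also have "\<dots> = (\<Sum>k<dim_row C. \<Sum>k'<dim_row D. (A $$ (i div dim_row B, k) * C $$ (k, j div dim_col D)) *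
      (B $$ (i mod dim_row B, k') * D $$ (k', j mod dim_col D)))"
    by (subst sum_lessThan_mult) (simp add: mult_ac)
  also have "\<dots> = (A * C) $$ (i div dim_row B, j div dim_col D) * (B * D) $$ (i mod dim_row B, j mod dim_col D)"
    using b assms by (simp add: scalar_prod_def atLeast0LessThan sum_product)
  also have "\<dots> = kron (A * C) (B * D) $$ (i, j)"
    using ij by (simp add: index_kron)
  finally show "(kron A B * kron C D) $$ (i, j) = kron (A * C) (B * D) $$ (i, j)" .
qed auto

text \<open>Both bracketings read off the same three digits of an index in mixed radix.\<close>

lemma kron_assoc: "kron (kron A B) C = kron A (kron B C)"
proof (rule eq_matI)
  fix i j
  assume "i < dim_row (kron A (kron B C))" "j < dim_col (kron A (kron B C))"
  then have ij: "i < dim_row A * (dim_row B * dim_row C)" "j < dim_col A * (dim_col B * dim_col C)"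
    by simp_all
  then have ij': "i < dim_row A * dim_row B * dim_row C" "j < dim_col A * dim_col B * dim_col C"
    by (simp_all add: mult.assoc)
  \<comment> \<open>The middle digit is obtained in either order of division. The case
    \<open>c = 0\<close> is separate: there \<open>x div 0 = 0\<close> and
    \<open>x mod 0 = x\<close>.\<close>
  have aux: "x mod (b * c) div c = x div c mod b" "x mod (b * c) mod c = x mod c"
    "x div (b * c) = x div c div b" for x b c :: nat
    by (cases "c = 0"; simp add: mod_mult2_eq div_mult2_eq mult.commute[of b c])+
  show "kron (kron A B) C $$ (i, j) = kron A (kron B C) $$ (i, j)"
    using ij ij' less_mult_imp_div_less[OF ij'(1)] less_mult_imp_div_less[OF ij'(2)]
      mod_less_of_less_mult[OF ij(1)] mod_less_of_less_mult[OF ij(2)]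
    by (simp add: index_kron aux mult.assoc)
qed (auto simp: mult.assoc)

lemma kron_one: "kron (1\<^sub>m a) (1\<^sub>m b) = 1\<^sub>m (a * b)"
proof (rule eq_matI)
  fix i j
  assume "i < dim_row (1\<^sub>m (a * b) :: complex mat)" "j < dim_col (1\<^sub>m (a * b) :: complex mat)"
  then have ij: "i < a * b" "j < a * b" by simp_all
  then show "kron (1\<^sub>m a) (1\<^sub>m b) $$ (i, j) = 1\<^sub>m (a * b) $$ (i, j)"
    using less_mult_imp_div_less[OF ij(1)] less_mult_imp_div_less[OF ij(2)]
      mod_less_of_less_mult[OF ij(1)] mod_less_of_less_mult[OF ij(2)] div_eq_mod_eq_imp_eq[of i b j]
    by (auto simp: index_kron)
qed auto

lemma kron_one_1_left [simp]: "kron (1\<^sub>m 1) A = A"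
  by (rule eq_matI) (auto simp: index_kron)

lemma kron_one_1_right [simp]: "kron A (1\<^sub>m 1) = A"
  by (rule eq_matI) (auto simp: index_kron)

section \<open>Tensor powers of a single matrix\<close>

primrec kron_pow :: "complex mat \<Rightarrow> nat \<Rightarrow> complex mat" where
  "kron_pow A 0 = 1\<^sub>m 1"
| "kron_pow A (Suc k) = kron (kron_pow A k) A"

lemma kron_pow_add: "kron_pow A (k + l) = kron (kron_pow A k) (kron_pow A l)"
  using kron_one_1_right by (induction l) (simp_all add: kron_assoc)

text \<open>The recursion adds factors on the right, whereas the auxiliary space to be traced out is
  the leftmost factor.\<close>

lemma kron_pow_Suc_left: "kron_pow A (Suc k) = kron A (kron_pow A k)"
  using kron_pow_add[of A 1 k] kron_one_1_left by simp

lemma kron_pow_carrier [simp]: "A \<in> carrier_mat d d \<Longrightarrow> kron_pow A k \<in> carrier_mat (d ^ k) (d ^ k)"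
proof (induction k)
  case (Suc k)
  then show ?case using kron_carrier[of "kron_pow A k" "d ^ k" "d ^ k" A d d] by (simp add: mult.commute)
qed simp

lemma dim_kron_pow:
  assumes "A \<in> carrier_mat d d"
  shows "dim_row (kron_pow A k) = d ^ k" "dim_col (kron_pow A k) = d ^ k"
  by (rule carrier_matD[OF kron_pow_carrier[OF assms]])+

lemma kron_pow_involution:
  assumes "A \<in> carrier_mat d d" "A * A = 1\<^sub>m d"
  shows "kron_pow A k * kron_pow A k = 1\<^sub>m (d ^ k)"
proof (induction k)
  case (Suc k)
  have "kron_pow A (Suc k) * kron_pow A (Suc k) = kron (kron_pow A k * kron_pow A k) (A * A)"
    using assms(1) by (simp add: kron_mult dim_kron_pow[OF assms(1)])
  then show ?case by (simp only: Suc assms(2) kron_one power_Suc mult.commute)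
qed simp

section \<open>Local operators\<close>

lemma power_split: "k < L \<Longrightarrow> d ^ k * (d * d ^ (L - 1 - k)) = d ^ L" for d :: nat
  by (metis Suc_diff_Suc diff_Suc_eq_diff_pred le_add_diff_inverse less_or_eq_imp_le power_Suc power_add)

lemma on1_carrier:
  assumes "k < L" "X \<in> carrier_mat d d"
  shows "on1 d L k X \<in> carrier_mat (d ^ L) (d ^ L)"
proof -
  have "on1 d L k X \<in> carrier_mat (d ^ k * (d * d ^ (L - 1 - k))) (d ^ k * (d * d ^ (L - 1 - k)))"
    unfolding on1_def using assms(2) by (intro kron_carrier) auto
  then show ?thesis by (simp only: power_split[OF assms(1)])
qed

text \<open>On factor \<open>k\<close> the hypothesis applies; on every other factor
  \<open>Z\<close> only meets an identity. \<open>X\<close> and \<open>Y\<close> may differ because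
  \<open>Z\<close> carries an elementary matrix to another one; the K-matrices use the case
  \<open>X = Y\<close>.\<close>

lemma kron_pow_on1_intertwine:
  assumes kL: "k < L" and Z: "Z \<in> carrier_mat d d" and X: "X \<in> carrier_mat d d" and Y: "Y \<in> carrier_mat d d"
    and eq: "Z * X = Y * Z"
  shows "kron_pow Z L * on1 d L k X = on1 d L k Y * kron_pow Z L"
proof -
  obtain r where L: "L = k + Suc r" using kL by (metis less_iff_Suc_add add_Suc_right)
  have P: "kron_pow Z L = kron (kron_pow Z k) (kron Z (kron_pow Z r))"
    unfolding L kron_pow_add kron_pow_Suc_left ..
  have r: "L - 1 - k = r" using L by simp
  have "kron_pow Z L * on1 d L k X = kron (kron_pow Z k) (kron (Z * X) (kron_pow Z r))"
    unfolding P on1_def r using Z X by (simp add: kron_mult dim_kron_pow[OF Z])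
  also have "\<dots> = on1 d L k Y * kron_pow Z L"
    unfolding P on1_def r eq using Z Y by (simp add: kron_mult dim_kron_pow[OF Z])
  finally show ?thesis .
qed

lemma msum_carrier [simp]: "msum m F S \<in> carrier_mat m m"
  by (simp add: msum_def)

text \<open>Moving \<open>G\<close> across the sum merely permutes the summands along
  \<open>\<tau>\<close>. Writing this as an intertwining relation avoids an inverse of
  \<open>G\<close>.\<close>

lemma msum_intertwine:
  assumes G: "G \<in> carrier_mat m m" and F: "\<And>s. s \<in> S \<Longrightarrow> F s \<in> carrier_mat m m"
    and bij: "bij_betw \<tau> S S" and eq: "\<And>s. s \<in> S \<Longrightarrow> G * F s = F (\<tau> s) * G"
  shows "G * msum m F S = msum m F S * G"
proof (rule eq_matI)
  fix i j
  assume "i < dim_row (msum m F S * G)" "j < dim_col (msum m F S * G)"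
  then have ij: "i < m" "j < m" using G by (simp_all add: msum_def)
  have "(G * msum m F S) $$ (i, j) = (\<Sum>l<m. \<Sum>s\<in>S. G $$ (i, l) * F s $$ (l, j))"
    using ij G by (simp add: scalar_prod_def msum_def atLeast0LessThan sum_distrib_left)
  also have "\<dots> = (\<Sum>s\<in>S. \<Sum>l<m. G $$ (i, l) * F s $$ (l, j))"
    by (rule sum.swap)
  also have "\<dots> = (\<Sum>s\<in>S. (G * F s) $$ (i, j))"
    using ij G F by (intro sum.cong refl) (fastforce simp: scalar_prod_def atLeast0LessThan)
  also have "\<dots> = (\<Sum>s\<in>S. (F (\<tau> s) * G) $$ (i, j))"
    by (simp add: eq)
  also have "\<dots> = (\<Sum>s\<in>S. (F s * G) $$ (i, j))"
    by (rule sum.reindex_bij_betw[OF bij])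
  also have "\<dots> = (\<Sum>s\<in>S. \<Sum>l<m. F s $$ (i, l) * G $$ (l, j))"
    using ij G F by (intro sum.cong refl) (fastforce simp: scalar_prod_def atLeast0LessThan)
  also have "\<dots> = (\<Sum>l<m. \<Sum>s\<in>S. F s $$ (i, l) * G $$ (l, j))"
    by (rule sum.swap)
  also have "\<dots> = (msum m F S * G) $$ (i, j)"
    using ij G by (simp add: scalar_prod_def msum_def atLeast0LessThan sum_distrib_right)
  finally show "(G * msum m F S) $$ (i, j) = (msum m F S * G) $$ (i, j)" .
qed (use G in \<open>auto simp: msum_def\<close>)

section \<open>Passing a fixed matrix through sums and ordered products\<close>

lemma intertwine_mult:
  fixes G :: "complex mat"
  assumes c: "G \<in> carrier_mat m m" "A \<in> carrier_mat m m" "B \<in> carrier_mat m m"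
    "A' \<in> carrier_mat m m" "B' \<in> carrier_mat m m"
    and eq: "G * A = A' * G" "G * B = B' * G"
  shows "G * (A * B) = A' * B' * G"
proof -
  have "G * (A * B) = A' * G * B" using assoc_mult_mat[OF c(1-3)] eq(1) by simp
  also have "\<dots> = A' * (B' * G)" using assoc_mult_mat[OF c(4,1,3)] eq(2) by simp
  also have "\<dots> = A' * B' * G" using assoc_mult_mat[OF c(4,5,1)] by simp
  finally show ?thesis .
qed

lemma commute_mult:
  fixes G :: "complex mat"
  assumes "G \<in> carrier_mat m m" "A \<in> carrier_mat m m" "B \<in> carrier_mat m m"
    and "G * A = A * G" "G * B = B * G"
  shows "G * (A * B) = A * B * G"
  using assms by (intro intertwine_mult)

lemma mprod_carrier:
  "(\<And>A. A \<in> set As \<Longrightarrow> A \<in> carrier_mat m m) \<Longrightarrow> mprod m As \<in> carrier_mat m m"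
proof (induction As)
  case (Cons A As)
  then have "A * mprod m As \<in> carrier_mat m m" by (intro mult_carrier_mat[of _ m m]) auto
  then show ?case by (simp add: mprod_def)
qed (simp add: mprod_def)

lemma mprod_commute:
  assumes "G \<in> carrier_mat m m"
  shows "(\<And>A. A \<in> set As \<Longrightarrow> A \<in> carrier_mat m m \<and> G * A = A * G) \<Longrightarrow> G * mprod m As = mprod m As * G"
proof (induction As)
  case Nil
  then show ?case using assms by (simp add: mprod_def)
next
  case (Cons A As)
  have "G * (A * mprod m As) = A * mprod m As * G"
    using Cons by (intro commute_mult[OF assms] mprod_carrier) auto
  then show ?case by (simp add: mprod_def)
qed

lemma mprod_snoc:
  assumes "\<And>A. A \<in> set As \<Longrightarrow> A \<in> carrier_mat m m" "B \<in> carrier_mat m m"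
  shows "mprod m (As @ [B]) = mprod m As * B"
  using assms(1)
proof (induction As)
  case Nil
  then show ?case using assms(2) by (simp add: mprod_def)
next
  case (Cons A As)
  then have "mprod m As \<in> carrier_mat m m" "A \<in> carrier_mat m m" by (auto intro: mprod_carrier)
  then have "A * (mprod m As * B) = A * mprod m As * B" using assms(2) by simp
  then show ?case using Cons by (simp add: mprod_def)
qed

text \<open>The case \<open>r = L\<close> is the goal; partial products are needed for the induction
  over the sites. Site \<open>k\<close> is factor \<open>k - 1\<close>, so step \<open>Suc r\<close>
  multiplies by \<open>Z\<close> on factor \<open>r\<close>, the first one on which the product so
  far is the identity.\<close>

lemma mprod_on1:
  assumes Z: "Z \<in> carrier_mat d d" and "r \<le> L"
  shows "mprod (d ^ L) (map (\<lambda>k. on1 d L (k - 1) Z) [1..<r + 1]) = kron (kron_pow Z r) (1\<^sub>m (d ^ (L - r)))"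
  using assms(2)
proof (induction r)
  case 0
  then show ?case using kron_one_1_left by (simp add: mprod_def)
next
  case (Suc r)
  have "mprod (d ^ L) (map (\<lambda>k. on1 d L (k - 1) Z) [1..<Suc r + 1])
      = mprod (d ^ L) (map (\<lambda>k. on1 d L (k - 1) Z) [1..<r + 1] @ [on1 d L r Z])"
    by simp
  also have "\<dots> = kron (kron_pow Z r) (1\<^sub>m (d ^ (L - r))) * on1 d L r Z"
    using Suc Z by (subst mprod_snoc) (auto intro!: on1_carrier simp del: upt_Suc)
  also have "\<dots> = kron (kron_pow Z r) (kron Z (1\<^sub>m (d ^ (L - 1 - r))))"
  proof -
    \<comment> \<open>One factor is split off the trailing identity to make room for the new
      \<open>Z\<close>.\<close>
    have "d ^ (L - r) = d * d ^ (L - 1 - r)"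
      using Suc.prems by (metis Suc_diff_Suc Suc_le_lessD diff_Suc_1 diff_commute power_Suc)
    then show ?thesis unfolding on1_def using Z
      by (simp add: kron_mult dim_kron_pow[OF Z] left_mult_one_mat[OF kron_carrier[OF Z one_carrier_mat]])
  qed
  finally show ?case by (simp add: kron_assoc)
qed

lemma mprod_on1_eq_kron_pow:
  assumes "Z \<in> carrier_mat d d"
  shows "mprod (d ^ L) (map (\<lambda>k. on1 d L (k - 1) Z) [1..<L + 1]) = kron_pow Z L"
  using mprod_on1[OF assms, of L L] kron_one_1_right by simp

section \<open>Permutation matrices\<close>

text \<open>Row \<open>i\<close> has its one in column \<open>f i\<close>. For an involution the
  matrix is symmetric, so the row and column conventions agree.\<close>

definition perm_mat_of :: "nat \<Rightarrow> (nat \<Rightarrow> nat) \<Rightarrow> complex mat" where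
  "perm_mat_of d f = mat d d (\<lambda>(i, j). if j = f i then 1 else 0)"

definition involution_on :: "nat set \<Rightarrow> (nat \<Rightarrow> nat) \<Rightarrow> bool" where
  "involution_on S f \<longleftrightarrow> (\<forall>i\<in>S. f i \<in> S \<and> f (f i) = i)"

lemma perm_mat_of_carrier [simp]: "perm_mat_of d f \<in> carrier_mat d d"
  by (simp add: perm_mat_of_def)

lemma perm_mat_of_mult_left:
  assumes "involution_on {..<d} f" "A \<in> carrier_mat d m"
  shows "perm_mat_of d f * A = mat d m (\<lambda>(i, j). A $$ (f i, j))"
proof (rule eq_matI)
  fix i j
  assume "i < dim_row (mat d m (\<lambda>(i, j). A $$ (f i, j)))" "j < dim_col (mat d m (\<lambda>(i, j). A $$ (f i, j)))"
  then have ij: "i < d" "j < m" by simp_all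
  have "(perm_mat_of d f * A) $$ (i, j) = (\<Sum>l<d. if l = f i then A $$ (l, j) else 0)"
    using ij assms(2)
    by (simp add: perm_mat_of_def scalar_prod_def atLeast0LessThan if_distrib[of "\<lambda>x. x * _"] cong: if_cong)
  also have "\<dots> = A $$ (f i, j)"
    using assms(1) ij by (simp add: involution_on_def)
  finally show "(perm_mat_of d f * A) $$ (i, j) = mat d m (\<lambda>(i, j). A $$ (f i, j)) $$ (i, j)"
    using ij by simp
qed (use assms(2) in \<open>auto simp: perm_mat_of_def\<close>)

lemma perm_mat_of_mult_right:
  assumes "involution_on {..<d} f" "A \<in> carrier_mat m d"
  shows "A * perm_mat_of d f = mat m d (\<lambda>(i, j). A $$ (i, f j))"
proof (rule eq_matI)
  fix i j
  assume "i < dim_row (mat m d (\<lambda>(i, j). A $$ (i, f j)))" "j < dim_col (mat m d (\<lambda>(i, j). A $$ (i, f j)))"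
  then have ij: "i < m" "j < d" by simp_all
  have "(A * perm_mat_of d f) $$ (i, j) = (\<Sum>l<d. A $$ (i, l) * (if j = f l then 1 else 0))"
    using ij assms(2) by (simp add: perm_mat_of_def scalar_prod_def atLeast0LessThan)
  \<comment> \<open>Since \<open>f\<close> is an involution on the indices, \<open>j = f l\<close>
    can be solved for \<open>l\<close>.\<close>
  also have "\<dots> = (\<Sum>l<d. if l = f j then A $$ (i, l) else 0)"
    using ij assms(1) by (intro sum.cong) (auto simp: involution_on_def)
  also have "\<dots> = A $$ (i, f j)"
    using assms(1) ij by (simp add: involution_on_def)
  finally show "(A * perm_mat_of d f) $$ (i, j) = mat m d (\<lambda>(i, j). A $$ (i, f j)) $$ (i, j)"
    using ij by simp
qed (use assms(2) in \<open>auto simp: perm_mat_of_def\<close>)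

lemma perm_mat_of_involution:
  assumes "involution_on {..<d} f"
  shows "perm_mat_of d f * perm_mat_of d f = 1\<^sub>m d"
  unfolding perm_mat_of_mult_left[OF assms perm_mat_of_carrier]
  using assms by (intro eq_matI) (auto simp: perm_mat_of_def involution_on_def)

text \<open>Commuting first says that permuting rows and permuting columns of \<open>A\<close>
  agree; substituting \<open>f j\<close> for \<open>j\<close> turns this into invariance under
  simultaneous relabelling. One direction serves the K-matrices, the other extracts the symmetry of
  the entries of an operator on two factors.\<close>

lemma perm_mat_of_commute_iff:
  assumes f: "involution_on {..<d} f" and A: "A \<in> carrier_mat d d"
  shows "perm_mat_of d f * A = A * perm_mat_of d f \<longleftrightarrow> (\<forall>i<d. \<forall>j<d. A $$ (f i, f j) = A $$ (i, j))"
proof -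
  have "perm_mat_of d f * A = A * perm_mat_of d f \<longleftrightarrow> (\<forall>i<d. \<forall>j<d. A $$ (f i, j) = A $$ (i, f j))"
    unfolding perm_mat_of_mult_left[OF f A] perm_mat_of_mult_right[OF f A]
    by (simp add: mat_eq_iff)
  also have "\<dots> \<longleftrightarrow> (\<forall>i<d. \<forall>j<d. A $$ (f i, f j) = A $$ (i, j))"
    using f unfolding involution_on_def by (metis lessThan_iff)
  finally show ?thesis .
qed

lemma kron_perm_mat_of:
  assumes "\<And>i. i < d \<Longrightarrow> f i < d"
  shows "kron (perm_mat_of d f) (perm_mat_of d f) = perm_mat_of (d * d) (\<lambda>i. f (i div d) * d + f (i mod d))"
proof (rule eq_matI)
  fix i j
  assume "i < dim_row (perm_mat_of (d * d) (\<lambda>i. f (i div d) * d + f (i mod d)))"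
    "j < dim_col (perm_mat_of (d * d) (\<lambda>i. f (i div d) * d + f (i mod d)))"
  then have ij: "i < d * d" "j < d * d" by (simp_all add: perm_mat_of_def)
  note b = less_mult_imp_div_less[OF ij(1)] less_mult_imp_div_less[OF ij(2)]
    mod_less_of_less_mult[OF ij(1)] mod_less_of_less_mult[OF ij(2)]
  \<comment> \<open>Uniqueness of division with remainder by \<open>d\<close>, using
    \<open>f (i mod d) < d\<close>.\<close>
  have "j = f (i div d) * d + f (i mod d) \<longleftrightarrow> j div d = f (i div d) \<and> j mod d = f (i mod d)"
    using assms[OF b(3)] by (metis div_mult_mod_eq div_mult_self3 mod_mult_self3 div_less mod_less add_0_right bot_nat_0.not_eq_extremum not_less0)
  then show "kron (perm_mat_of d f) (perm_mat_of d f) $$ (i, j)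
      = perm_mat_of (d * d) (\<lambda>i. f (i div d) * d + f (i mod d)) $$ (i, j)"
    using ij b by (simp add: index_kron perm_mat_of_def)
qed (auto simp: perm_mat_of_def)

lemma involution_on_pair:
  assumes "involution_on {..<d} f"
  shows "involution_on {..<d * d} (\<lambda>i. f (i div d) * d + f (i mod d))"
  unfolding involution_on_def
proof
  fix i assume "i \<in> {..<d * d}"
  then have "i < d * d" by simp
  note b = less_mult_imp_div_less[OF this] mod_less_of_less_mult[OF this]
  show "f (i div d) * d + f (i mod d) \<in> {..<d * d} \<and>
      f ((f (i div d) * d + f (i mod d)) div d) * d + f ((f (i div d) * d + f (i mod d)) mod d) = i"
    using assms b by (auto simp: involution_on_def pair_less)
qed

lemma elem_mat_carrier [simp]: "elem_mat d \<alpha> \<beta> \<in> carrier_mat d d"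
  by (simp add: elem_mat_def)

lemma dim_elem_mat [simp]: "dim_row (elem_mat d \<alpha> \<beta>) = d" "dim_col (elem_mat d \<alpha> \<beta>) = d"
  by (simp_all add: elem_mat_def)

lemma involution_on_bij_betw: "involution_on S f \<Longrightarrow> bij_betw f S S"
  by (rule bij_betw_byWitness[where f' = f]) (auto simp: involution_on_def)

section \<open>The exchange of the two middle labels\<close>

text \<open>Labels count from 1 and matrix indices from 0: the exchange of the two middle basis
  vectors is \<open>flip n\<close> on labels and \<open>flip (n - 1)\<close> on indices.
  \<open>Suc_flip\<close> translates between the two.\<close>

definition flip :: "nat \<Rightarrow> nat \<Rightarrow> nat" where
  "flip n = Transposition.transpose n (Suc n)"

lemma flip_flip [simp]: "flip n (flip n \<alpha>) = \<alpha>"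
  by (simp add: flip_def)

lemma flip_eq_iff [simp]: "flip n \<alpha> = flip n \<beta> \<longleftrightarrow> \<alpha> = \<beta>"
  by (metis flip_flip)

lemma flip_cases: "flip n \<alpha> = (if \<alpha> = n then Suc n else if \<alpha> = Suc n then n else \<alpha>)"
  by (simp add: flip_def Transposition.transpose_def)

lemma flip_mem: "n \<ge> 1 \<Longrightarrow> \<alpha> \<in> {1..2 * n} \<Longrightarrow> flip n \<alpha> \<in> {1..2 * n}"
  by (auto simp: flip_cases)

lemma involution_on_flip: "n \<ge> 1 \<Longrightarrow> involution_on {..<2 * n} (flip (n - 1))"
  unfolding involution_on_def by (auto simp: flip_cases)

lemma Suc_flip: "n \<ge> 1 \<Longrightarrow> Suc (flip (n - 1) i) = flip n (Suc i)"
  by (auto simp: flip_cases)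

lemma dual_flip: "\<alpha> \<in> {1..2 * n} \<Longrightarrow> n \<ge> 1 \<Longrightarrow> dual n (flip n \<alpha>) = flip n (dual n \<alpha>)"
  by (auto simp: flip_cases dual_def)

lemma bar_flip: "bar n (flip n \<alpha>) = bar n \<alpha>"
  by (auto simp: flip_cases bar_def)

text \<open>The exchange reverses the order only of the pair formed by \<open>n\<close> and
  \<open>Suc n\<close>, and these two labels are dual to each other.\<close>

lemma flip_less_iff:
  "n \<ge> 1 \<Longrightarrow> \<beta> \<in> {1..2 * n} \<Longrightarrow> \<alpha> \<noteq> dual n \<beta> \<Longrightarrow> flip n \<alpha> < flip n \<beta> \<longleftrightarrow> \<alpha> < \<beta>"
  by (auto simp: flip_cases dual_def)

lemma Z_left_eq:
  assumes "n \<ge> 1"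
  shows "Z_left n = perm_mat_of (2 * n) (flip (n - 1))"
proof -
  \<comment> \<open>With this substitution the blocks have sizes \<open>a\<close>, 2,
    \<open>a\<close>, and no truncated subtraction is left.\<close>
  obtain a where n: "n = Suc a" using assms by (cases n) auto
  show ?thesis
    unfolding n Z_left_def perm_mat_of_def
    by (rule eq_matI)
       (auto simp: Let_def flip_cases mat_of_rows_list_def nth_Cons' split: if_splits)
qed

lemma Z_left_carrier: "n \<ge> 1 \<Longrightarrow> Z_left n \<in> carrier_mat (2 * n) (2 * n)"
  by (simp add: Z_left_eq)

lemma Z_left_involution: "n \<ge> 1 \<Longrightarrow> Z_left n * Z_left n = 1\<^sub>m (2 * n)"
  by (simp only: Z_left_eq perm_mat_of_involution involution_on_flip)

lemma Z_left_elem_mat: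
  assumes "n \<ge> 1"
  shows "Z_left n * elem_mat (2 * n) \<alpha> \<beta> = elem_mat (2 * n) (flip n \<alpha>) (flip n \<beta>) * Z_left n"
  unfolding Z_left_eq[OF assms] perm_mat_of_mult_left[OF involution_on_flip[OF assms] elem_mat_carrier]
    perm_mat_of_mult_right[OF involution_on_flip[OF assms] elem_mat_carrier]
proof (rule cong_mat[OF refl refl])
  fix i j assume ij: "i < 2 * n" "j < 2 * n"
  then have "flip (n - 1) i < 2 * n" "flip (n - 1) j < 2 * n"
    using involution_on_flip[OF assms] by (auto simp: involution_on_def)
  moreover have "flip n (i + 1) = \<alpha> \<longleftrightarrow> i + 1 = flip n \<alpha>"
    by (metis flip_flip)
  moreover have "flip (n - 1) i + 1 = flip n (i + 1)" "flip (n - 1) j + 1 = flip n (j + 1)"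
    using Suc_flip[OF assms] by simp_all
  ultimately show "(case (i, j) of (i, j) \<Rightarrow> elem_mat (2 * n) \<alpha> \<beta> $$ (flip (n - 1) i, j))
      = (case (i, j) of (i, j) \<Rightarrow> elem_mat (2 * n) (flip n \<alpha>) (flip n \<beta>) $$ (i, flip (n - 1) j))"
    using ij by (simp add: elem_mat_def del: One_nat_def)
qed

section \<open>Symmetry of the R-matrix and of the K-matrices\<close>

text \<open>The \<open>bar\<close> values cancel and the duality term is present in both orders.
  Although the two expressions differ in all their signs, each equals
  \<open>2 * sinh (2 * \<eta>) * sinh (kappa n * \<eta>)\<close>, which does not depend on
  \<open>u\<close>.\<close>

lemma a_coeff_middle: "a_coeff n \<eta> u n (Suc n) = a_coeff n \<eta> u (Suc n) n"
proof -
  have s: "sinh x = (exp x - exp (- x)) / 2" for x :: complex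
    by (simp add: sinh_field_def)
  \<comment> \<open>Here \<open>v\<close> stands for \<open>u / 2\<close> and \<open>k\<close> for
    \<open>kappa n * \<eta>\<close>. In exponentials, the terms \<open>exp (k - v)\<close> cancel in
    the bracket and leave \<open>exp v * sinh k\<close>; the lower sign is the mirror image.\<close>
  have up: "exp (- v) * (exp k * sinh v - sinh (v - k)) = sinh k" for v k :: complex
    by (simp add: s exp_diff exp_minus field_simps)
  have lo: "exp v * (exp (- k) * sinh v - sinh (v - k)) = sinh k" for v k :: complex
    by (simp add: s exp_diff exp_minus field_simps)
  have "a_coeff n \<eta> u n (Suc n) = 2 * sinh (2 * \<eta>) *
      (exp (- (u / 2)) * (exp (kappa n * \<eta>) * sinh (u / 2) - sinh (u / 2 - kappa n * \<eta>)))"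
    by (simp add: a_coeff_def dual_def bar_def mult_ac)
  moreover have "a_coeff n \<eta> u (Suc n) n = 2 * sinh (2 * \<eta>) *
      (exp (u / 2) * (exp (- (kappa n * \<eta>)) * sinh (u / 2) - sinh (u / 2 - kappa n * \<eta>)))"
    by (simp add: a_coeff_def dual_def bar_def mult_ac)
  ultimately show ?thesis by (simp only: up lo)
qed

lemma a_coeff_flip:
  assumes n: "n \<ge> 1" and \<alpha>\<beta>: "\<alpha> \<in> {1..2 * n}" "\<beta> \<in> {1..2 * n}"
  shows "a_coeff n \<eta> u (flip n \<alpha>) (flip n \<beta>) = a_coeff n \<eta> u \<alpha> \<beta>"
proof (cases "{\<alpha>, \<beta>} = {n, Suc n}")
  case True
  then have "\<alpha> = n \<and> \<beta> = Suc n \<or> \<alpha> = Suc n \<and> \<beta> = n" by (auto simp: doubleton_eq_iff)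
  then show ?thesis by (auto simp: flip_cases a_coeff_middle)
next
  case False
  \<comment> \<open>Away from the middle pair the order, and with it the sign \<open>s\<close>, is
    kept; the rest of the coefficient depends on the labels only through equality,
    \<open>dual\<close> and \<open>bar\<close>.\<close>
  have "flip n \<alpha> < flip n \<beta> \<longleftrightarrow> \<alpha> < \<beta>" using False by (auto simp: flip_cases)
  then show ?thesis
    using dual_flip[OF \<alpha>\<beta>(2) n] by (simp add: a_coeff_def bar_flip)
qed

lemma kron_elem_mat_flip:
  assumes "n \<ge> 1"
  shows "kron (Z_left n) (Z_left n) * kron (elem_mat (2 * n) \<alpha> \<beta>) (elem_mat (2 * n) \<mu> \<nu>)
    = kron (elem_mat (2 * n) (flip n \<alpha>) (flip n \<beta>)) (elem_mat (2 * n) (flip n \<mu>) (flip n \<nu>)) * kron (Z_left n) (Z_left n)"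
  using Z_left_carrier[OF assms] by (simp add: kron_mult Z_left_elem_mat[OF assms])

lemma bij_betw_flip: "n \<ge> 1 \<Longrightarrow> bij_betw (flip n) {1..2 * n} {1..2 * n}"
  by (intro involution_on_bij_betw) (simp add: involution_on_def flip_mem del: atLeastAtMost_iff One_nat_def)

lemma bij_betw_map_prod_flip:
  assumes "\<And>\<alpha> \<beta>. (\<alpha>, \<beta>) \<in> S \<Longrightarrow> (flip n \<alpha>, flip n \<beta>) \<in> S"
  shows "bij_betw (\<lambda>(\<alpha>, \<beta>). (flip n \<alpha>, flip n \<beta>)) S S"
  by (rule bij_betw_byWitness[where f' = "\<lambda>(\<alpha>, \<beta>). (flip n \<alpha>, flip n \<beta>)"]) (auto intro: assms)

lemma smult_intertwine:
  fixes G :: "complex mat"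
  assumes "G \<in> carrier_mat m m" "A \<in> carrier_mat m m" "B \<in> carrier_mat m m" "G * A = B * G"
  shows "G * (c \<cdot>\<^sub>m A) = (c \<cdot>\<^sub>m B) * G"
  using assms by (metis mult_smult_distrib mult_smult_assoc_mat)

lemma commute_add:
  fixes G :: "complex mat"
  assumes "G \<in> carrier_mat m m" "A \<in> carrier_mat m m" "B \<in> carrier_mat m m" "G * A = A * G" "G * B = B * G"
  shows "G * (A + B) = (A + B) * G"
  using assms by (metis add_mult_distrib_mat mult_add_distrib_mat)

lemma R_mat_carrier [simp]: "R_mat n \<eta> u \<in> carrier_mat (2 * n * (2 * n)) (2 * n * (2 * n))"
  by (simp add: R_mat_def Let_def msum_def)

lemma kron_Z_left_carrier:
  "n \<ge> 1 \<Longrightarrow> kron (Z_left n) (Z_left n) \<in> carrier_mat (2 * n * (2 * n)) (2 * n * (2 * n))"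
  by (intro kron_carrier Z_left_carrier)

text \<open>\<open>R\<close> is split into its five sums. The first four have a common coefficient,
  so it suffices that the index set is stable under the exchange; the last runs over all pairs of
  labels and needs the invariance of the individual coefficients.\<close>

lemma R_mat_commute:
  assumes n: "n \<ge> 1"
  shows "kron (Z_left n) (Z_left n) * R_mat n \<eta> u = R_mat n \<eta> u * kron (Z_left n) (Z_left n)"
proof -
  let ?d = "2 * n" and ?G = "kron (Z_left n) (Z_left n)" and ?e = "elem_mat (2 * n)"
  note G = kron_Z_left_carrier[OF n]
  have e: "kron (?e \<alpha> \<beta>) (?e \<mu> \<nu>) \<in> carrier_mat (?d * ?d) (?d * ?d)" for \<alpha> \<beta> \<mu> \<nu>
    by (intro kron_carrier elem_mat_carrier)
  note fm = flip_mem[OF n]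
  have dualne: "flip n \<alpha> \<noteq> dual n (flip n \<beta>)" if "\<alpha> \<noteq> dual n \<beta>" "\<beta> \<in> {1..?d}" for \<alpha> \<beta>
    using that by (simp add: dual_flip[OF that(2) n])
  have c: "?G * msum (?d * ?d) (\<lambda>\<alpha>. kron (?e \<alpha> \<alpha>) (?e \<alpha> \<alpha>)) {1..?d}
      = msum (?d * ?d) (\<lambda>\<alpha>. kron (?e \<alpha> \<alpha>) (?e \<alpha> \<alpha>)) {1..?d} * ?G"
    by (rule msum_intertwine[OF G e bij_betw_flip[OF n]]) (rule kron_elem_mat_flip[OF n])
  have b: "?G * msum (?d * ?d) (\<lambda>(\<alpha>, \<beta>). kron (?e \<alpha> \<alpha>) (?e \<beta> \<beta>)) S
      = msum (?d * ?d) (\<lambda>(\<alpha>, \<beta>). kron (?e \<alpha> \<alpha>) (?e \<beta> \<beta>)) S * ?G"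
    if "S = {(\<alpha>, \<beta>) \<in> {1..?d} \<times> {1..?d}. \<alpha> \<noteq> \<beta> \<and> \<alpha> \<noteq> dual n \<beta>}" for S
    by (rule msum_intertwine[OF G _ bij_betw_map_prod_flip])
       (use that fm dualne e kron_elem_mat_flip[OF n] in \<open>auto simp del: atLeastAtMost_iff One_nat_def\<close>)
  have lt: "?G * msum (?d * ?d) (\<lambda>(\<alpha>, \<beta>). kron (?e \<alpha> \<beta>) (?e \<beta> \<alpha>)) S
      = msum (?d * ?d) (\<lambda>(\<alpha>, \<beta>). kron (?e \<alpha> \<beta>) (?e \<beta> \<alpha>)) S * ?G"
    if "S = {(\<alpha>, \<beta>) \<in> {1..?d} \<times> {1..?d}. \<alpha> < \<beta> \<and> \<alpha> \<noteq> dual n \<beta>}" for S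
    by (rule msum_intertwine[OF G _ bij_betw_map_prod_flip])
       (use that fm dualne e kron_elem_mat_flip[OF n] flip_less_iff[OF n] in \<open>auto simp del: atLeastAtMost_iff One_nat_def\<close>)
  have gt: "?G * msum (?d * ?d) (\<lambda>(\<alpha>, \<beta>). kron (?e \<alpha> \<beta>) (?e \<beta> \<alpha>)) S
      = msum (?d * ?d) (\<lambda>(\<alpha>, \<beta>). kron (?e \<alpha> \<beta>) (?e \<beta> \<alpha>)) S * ?G"
    if S: "S = {(\<alpha>, \<beta>) \<in> {1..?d} \<times> {1..?d}. \<alpha> > \<beta> \<and> \<alpha> \<noteq> dual n \<beta>}" for S
  proof (rule msum_intertwine[OF G _ bij_betw_map_prod_flip])
    fix \<alpha> \<beta> assume s: "(\<alpha>, \<beta>) \<in> S"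
    \<comment> \<open>The order lemma is applied with the roles of the two labels exchanged. Its
      side condition \<open>\<beta> \<noteq> dual n \<alpha>\<close> is equivalent to the one in
      \<open>S\<close>, since duality is an involution on the labels.\<close>
    then have "flip n \<beta> < flip n \<alpha>" using flip_less_iff[OF n, of \<alpha> \<beta>] S
      by (auto simp: dual_def)
    then show "(flip n \<alpha>, flip n \<beta>) \<in> S" using s S fm dualne by (auto simp del: atLeastAtMost_iff One_nat_def)
  qed (use e kron_elem_mat_flip[OF n] in auto)
  have a: "?G * msum (?d * ?d) (\<lambda>(\<alpha>, \<beta>). a_coeff n \<eta> u \<alpha> \<beta> \<cdot>\<^sub>m kron (?e \<alpha> \<beta>) (?e (dual n \<alpha>) (dual n \<beta>)))
        ({1..?d} \<times> {1..?d})
      = msum (?d * ?d) (\<lambda>(\<alpha>, \<beta>). a_coeff n \<eta> u \<alpha> \<beta> \<cdot>\<^sub>m kron (?e \<alpha> \<beta>) (?e (dual n \<alpha>) (dual n \<beta>)))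
        ({1..?d} \<times> {1..?d}) * ?G"
  proof (rule msum_intertwine[OF G _ bij_betw_map_prod_flip])
    fix s assume "s \<in> {1..?d} \<times> {1..?d}"
    then obtain \<alpha> \<beta> where s: "s = (\<alpha>, \<beta>)" "\<alpha> \<in> {1..?d}" "\<beta> \<in> {1..?d}" by blast
    have "?G * (a_coeff n \<eta> u \<alpha> \<beta> \<cdot>\<^sub>m kron (?e \<alpha> \<beta>) (?e (dual n \<alpha>) (dual n \<beta>)))
      = a_coeff n \<eta> u \<alpha> \<beta> \<cdot>\<^sub>m kron (?e (flip n \<alpha>) (flip n \<beta>)) (?e (flip n (dual n \<alpha>)) (flip n (dual n \<beta>))) * ?G"
      by (rule smult_intertwine[OF G e e kron_elem_mat_flip[OF n]])
    then show "?G * (case s of (\<alpha>, \<beta>) \<Rightarrow> a_coeff n \<eta> u \<alpha> \<beta> \<cdot>\<^sub>m kron (?e \<alpha> \<beta>) (?e (dual n \<alpha>) (dual n \<beta>)))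
      = (case (case s of (\<alpha>, \<beta>) \<Rightarrow> (flip n \<alpha>, flip n \<beta>)) of
          (\<alpha>, \<beta>) \<Rightarrow> a_coeff n \<eta> u \<alpha> \<beta> \<cdot>\<^sub>m kron (?e \<alpha> \<beta>) (?e (dual n \<alpha>) (dual n \<beta>))) * ?G"
      \<comment> \<open>\<open>dual_flip\<close> makes the second leg again the dual of the first
        after relabelling, and \<open>a_coeff_flip\<close> lets the coefficient follow.\<close>
      by (simp only: s(1) prod.case a_coeff_flip[OF n s(2,3)] dual_flip[OF s(2) n] dual_flip[OF s(3) n])
    show "(case s of (\<alpha>, \<beta>) \<Rightarrow> a_coeff n \<eta> u \<alpha> \<beta> \<cdot>\<^sub>m kron (?e \<alpha> \<beta>) (?e (dual n \<alpha>) (dual n \<beta>)))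
      \<in> carrier_mat (?d * ?d) (?d * ?d)"
      using e by (simp only: s(1) prod.case smult_carrier_mat)
  next
    show "(flip n \<alpha>, flip n \<beta>) \<in> {1..?d} \<times> {1..?d}" if "(\<alpha>, \<beta>) \<in> {1..?d} \<times> {1..?d}" for \<alpha> \<beta>
      using that fm by (simp only: mem_Times_iff fst_conv snd_conv simp_thms)
  qed
  show ?thesis
    unfolding R_mat_def Let_def
    by (intro commute_add[OF G] smult_intertwine[OF G] add_carrier_mat smult_carrier_mat msum_carrier
        c b lt gt a refl)
qed

lemma perm_mat_commute:
  assumes n: "n \<ge> 1"
  shows "kron (Z_left n) (Z_left n) * perm_mat (2 * n) = perm_mat (2 * n) * kron (Z_left n) (Z_left n)"
  unfolding perm_mat_def
proof (rule msum_intertwine[OF kron_Z_left_carrier[OF n] _ bij_betw_map_prod_flip])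
  show "(flip n \<alpha>, flip n \<beta>) \<in> {1..2 * n} \<times> {1..2 * n}" if "(\<alpha>, \<beta>) \<in> {1..2 * n} \<times> {1..2 * n}" for \<alpha> \<beta>
    using that flip_mem[OF n] by (auto simp del: atLeastAtMost_iff One_nat_def)
qed (auto simp: kron_elem_mat_flip[OF n])

text \<open>Commutation on two factors is lifted to \<open>L\<close> factors. It makes the entries
  of \<open>X\<close> invariant under relabelling, while the tensor power of \<open>Z\<close>
  relabels the elementary operators in the expansion of \<open>on2\<close>; hence it only permutes
  the terms of that expansion.\<close>

lemma kron_pow_on2_commute:
  assumes n: "n \<ge> 1" and kl: "k < L" "l < L" and X: "X \<in> carrier_mat (2 * n * (2 * n)) (2 * n * (2 * n))"
    and comm: "kron (Z_left n) (Z_left n) * X = X * kron (Z_left n) (Z_left n)"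
  shows "kron_pow (Z_left n) L * on2 (2 * n) L k l X = on2 (2 * n) L k l X * kron_pow (Z_left n) L"
proof -
  let ?d = "2 * n" and ?f = "flip (n - 1)" and ?e = "elem_mat (2 * n)" and ?G = "kron_pow (Z_left n) L"
  let ?I = "{1..?d}"
  let ?F = "\<lambda>(\<alpha>, \<beta>, \<mu>, \<nu>). X $$ ((\<alpha> - 1) * ?d + (\<mu> - 1), (\<beta> - 1) * ?d + (\<nu> - 1)) \<cdot>\<^sub>m
        (on1 ?d L k (?e \<alpha> \<beta>) * on1 ?d L l (?e \<mu> \<nu>))"
  let ?t = "\<lambda>(\<alpha>, \<beta>, \<mu>, \<nu>). (flip n \<alpha>, flip n \<beta>, flip n \<mu>, flip n \<nu>)"
  note inv = involution_on_flip[OF n] and Z = Z_left_carrier[OF n]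
  have G: "?G \<in> carrier_mat (?d ^ L) (?d ^ L)" by (rule kron_pow_carrier[OF Z])
  have f: "?f i < ?d" if "i < ?d" for i using inv that by (auto simp: involution_on_def)
  have Xf: "X $$ (?f a * ?d + ?f m, ?f b * ?d + ?f v) = X $$ (a * ?d + m, b * ?d + v)"
    if "a < ?d" "m < ?d" "b < ?d" "v < ?d" for a m b v
  proof -
    have "\<forall>i<?d * ?d. \<forall>j<?d * ?d. X $$ (?f (i div ?d) * ?d + ?f (i mod ?d), ?f (j div ?d) * ?d + ?f (j mod ?d)) = X $$ (i, j)"
      by (rule iffD1[OF perm_mat_of_commute_iff[OF involution_on_pair[OF inv] X]])
         (use comm in \<open>simp only: Z_left_eq[OF n] kron_perm_mat_of[OF f]\<close>)
    from this[rule_format, OF pair_less[OF that(1,2)] pair_less[OF that(3,4)]]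
    show ?thesis using that by simp
  qed
  \<comment> \<open>Passage from labels in the expansion to matrix indices of
    \<open>X\<close>.\<close>
  have f1: "flip n \<alpha> - 1 = ?f (\<alpha> - 1)" if "\<alpha> \<in> ?I" for \<alpha>
    using Suc_flip[OF n, of "\<alpha> - 1"] that by simp
  have XF: "X $$ ((flip n \<alpha> - 1) * ?d + (flip n \<mu> - 1), (flip n \<beta> - 1) * ?d + (flip n \<nu> - 1))
     = X $$ ((\<alpha> - 1) * ?d + (\<mu> - 1), (\<beta> - 1) * ?d + (\<nu> - 1))"
    if "\<alpha> \<in> ?I" "\<beta> \<in> ?I" "\<mu> \<in> ?I" "\<nu> \<in> ?I" for \<alpha> \<beta> \<mu> \<nu>
    unfolding f1[OF that(1)] f1[OF that(2)] f1[OF that(3)] f1[OF that(4)]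
    by (rule Xf) (use that in auto)
  have c: "on1 ?d L k (?e \<alpha> \<beta>) \<in> carrier_mat (?d ^ L) (?d ^ L)" "on1 ?d L l (?e \<alpha> \<beta>) \<in> carrier_mat (?d ^ L) (?d ^ L)" for \<alpha> \<beta>
    by (rule on1_carrier[OF kl(1) elem_mat_carrier], rule on1_carrier[OF kl(2) elem_mat_carrier])
  have prod: "?G * (on1 ?d L k (?e \<alpha> \<beta>) * on1 ?d L l (?e \<mu> \<nu>)) =
      on1 ?d L k (?e (flip n \<alpha>) (flip n \<beta>)) * on1 ?d L l (?e (flip n \<mu>) (flip n \<nu>)) * ?G" for \<alpha> \<beta> \<mu> \<nu>
  proof -
    have "?G * on1 ?d L k (?e \<alpha> \<beta>) = on1 ?d L k (?e (flip n \<alpha>) (flip n \<beta>)) * ?G"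
      "?G * on1 ?d L l (?e \<mu> \<nu>) = on1 ?d L l (?e (flip n \<mu>) (flip n \<nu>)) * ?G"
      using kl by (intro kron_pow_on1_intertwine Z elem_mat_carrier Z_left_elem_mat n; simp)+
    then show ?thesis using G c by (intro intertwine_mult)
  qed
  show ?thesis
    unfolding on2_def
  proof (rule msum_intertwine[OF G])
    show "bij_betw ?t (?I \<times> ?I \<times> ?I \<times> ?I) (?I \<times> ?I \<times> ?I \<times> ?I)"
      by (rule bij_betw_byWitness[where f' = ?t]) (use flip_mem[OF n] in \<open>auto simp del: atLeastAtMost_iff One_nat_def\<close>)
  next
    fix s assume "s \<in> ?I \<times> ?I \<times> ?I \<times> ?I"
    then obtain \<alpha> \<beta> \<mu> \<nu> where s: "s = (\<alpha>, \<beta>, \<mu>, \<nu>)" "\<alpha> \<in> ?I" "\<beta> \<in> ?I" "\<mu> \<in> ?I" "\<nu> \<in> ?I"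
      by blast
    show "?F s \<in> carrier_mat (?d ^ L) (?d ^ L)" 
      unfolding s(1) prod.case by (intro smult_carrier_mat mult_carrier_mat[OF c(1) c(2)])
    show "?G * ?F s = ?F (?t s) * ?G"
      unfolding s(1) prod.case XF[OF s(2-5)]
      by (rule smult_intertwine[OF G mult_carrier_mat[OF c(1) c(2)] mult_carrier_mat[OF c(1) c(2)] prod])
  qed
qed

section \<open>The boundary K-matrices\<close>

lemma KR_carrier [simp]: "KR n \<eta> \<gamma>0 p u \<in> carrier_mat (2 * n) (2 * n)"
  by (simp add: KR_def)

text \<open>The exchanged indices \<open>n - 1\<close> and \<open>n\<close> both lie in the middle
  block, from \<open>p\<close> up to \<open>2 * n - p - 1\<close>, because \<open>p < n\<close>; on
  this block the diagonal is constant.\<close>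

lemma KR_commute:
  assumes "p < n"
  shows "Z_left n * KR n \<eta> \<gamma>0 p u = KR n \<eta> \<gamma>0 p u * Z_left n"
proof -
  have n: "n \<ge> 1" using assms by simp
  show ?thesis
    unfolding Z_left_eq[OF n] perm_mat_of_commute_iff[OF involution_on_flip[OF n] KR_carrier]
  proof (intro allI impI)
    fix i j assume ij: "i < 2 * n" "j < 2 * n"
    then have "flip (n - 1) i < 2 * n" "flip (n - 1) j < 2 * n"
      using involution_on_flip[OF n] by (auto simp: involution_on_def)
    moreover have "flip (n - 1) i < p \<longleftrightarrow> i < p" "flip (n - 1) i < 2 * n - p \<longleftrightarrow> i < 2 * n - p" for i
      using assms unfolding flip_cases by presburger+
    ultimately show "KR n \<eta> \<gamma>0 p u $$ (flip (n - 1) i, flip (n - 1) j) = KR n \<eta> \<gamma>0 p u $$ (i, j)"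
      using ij unfolding KR_def by (simp del: One_nat_def)
  qed
qed

lemma KL_carrier [simp]: "KL n \<eta> \<gamma>0 p u \<in> carrier_mat (2 * n) (2 * n)"
  unfolding KL_def M_mat_def by (rule mult_carrier_mat[OF KR_carrier msum_carrier])

text \<open>The extra factor \<open>M_mat\<close> depends on a label only through
  \<open>bar\<close>, which takes equal values at the two middle labels.\<close>

lemma KL_commute:
  assumes "p < n"
  shows "Z_left n * KL n \<eta> \<gamma>0 p u = KL n \<eta> \<gamma>0 p u * Z_left n"
proof -
  have n: "n \<ge> 1" using assms by simp
  have "Z_left n * M_mat n \<eta> = M_mat n \<eta> * Z_left n"
    unfolding M_mat_def
  proof (rule msum_intertwine[OF Z_left_carrier[OF n] _ bij_betw_flip[OF n]])
    show "Z_left n * (exp (4 * ((2 * of_nat n + 1) / 2 - bar n \<alpha>) * \<eta>) \<cdot>\<^sub>m elem_mat (2 * n) \<alpha> \<alpha>)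
      = exp (4 * ((2 * of_nat n + 1) / 2 - bar n (flip n \<alpha>)) * \<eta>) \<cdot>\<^sub>m elem_mat (2 * n) (flip n \<alpha>) (flip n \<alpha>) * Z_left n" for \<alpha>
      unfolding bar_flip
      by (rule smult_intertwine[OF Z_left_carrier[OF n] elem_mat_carrier elem_mat_carrier Z_left_elem_mat[OF n]])
  qed simp
  then show ?thesis
    unfolding KL_def
    by (intro commute_mult[OF Z_left_carrier[OF n] KR_carrier _ KR_commute[OF assms]]) (simp_all add: M_mat_def)
qed

section \<open>Partial trace\<close>

lemma mult_index_sum:
  assumes "A \<in> carrier_mat a b" "B \<in> carrier_mat b c" "i < a" "j < c"
  shows "(A * B) $$ (i, j) = (\<Sum>l<b. A $$ (i, l) * B $$ (l, j))"
  using assms by (simp add: scalar_prod_def atLeast0LessThan)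

lemma sum_lessThan_mult':
  fixes f :: "nat \<Rightarrow> 'a::comm_monoid_add"
  shows "(\<Sum>l<a * b. f l) = (\<Sum>k<a. \<Sum>j<b. f (k * b + j))"
  using sum_lessThan_mult[of "\<lambda>k j. f (k * b + j)" b a] by simp

lemma index_kron_pair:
  assumes "A \<in> carrier_mat d d" "B \<in> carrier_mat m m" "k < d" "k' < d" "i < m" "j < m"
  shows "kron A B $$ (k * m + i, k' * m + j) = A $$ (k, k') * B $$ (i, j)"
  using assms pair_less[of k d i m] pair_less[of k' d j m] by (simp add: index_kron)

lemma trace_first_carrier [simp]: "trace_first d m A \<in> carrier_mat m m"
  by (simp add: trace_first_def)

lemma index_trace_first: "i < m \<Longrightarrow> j < m \<Longrightarrow> trace_first d m A $$ (i, j) = (\<Sum>k<d. A $$ (k * m + i, k * m + j))"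
  by (simp add: trace_first_def)

text \<open>With the traced factor leftmost, \<open>A\<close> is a \<open>d\<close> by
  \<open>d\<close> array of \<open>m\<close> by \<open>m\<close> blocks and the partial trace adds
  the diagonal ones. The identity on the first leg forces \<open>k = k'\<close>, so each block is
  just multiplied by \<open>H\<close>.\<close>

lemma trace_first_mult_left:
  assumes H: "H \<in> carrier_mat m m" and A: "A \<in> carrier_mat (d * m) (d * m)"
  shows "trace_first d m (kron (1\<^sub>m d) H * A) = H * trace_first d m A"
proof (rule eq_matI)
  fix i j
  assume "i < dim_row (H * trace_first d m A)" "j < dim_col (H * trace_first d m A)"
  then have ij: "i < m" "j < m" using H by (simp_all add: trace_first_def)
  have K: "kron (1\<^sub>m d) H \<in> carrier_mat (d * m) (d * m)" using H by simp
  have "trace_first d m (kron (1\<^sub>m d) H * A) $$ (i, j) = (\<Sum>k<d. \<Sum>k'<d. \<Sum>l<m. (if k = k' then H $$ (i, l) * A $$ (k * m + l, k * m + j) else 0))"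
    using ij by (auto simp: index_trace_first mult_index_sum[OF K A] pair_less sum_lessThan_mult'
        index_kron_pair[OF one_carrier_mat H] intro!: sum.cong)
  also have "\<dots> = (\<Sum>k<d. \<Sum>l<m. H $$ (i, l) * A $$ (k * m + l, k * m + j))"
    by (subst sum.swap) (simp add: sum.swap[of _ "{..<m}"] if_distrib cong: if_cong)
  also have "\<dots> = (H * trace_first d m A) $$ (i, j)"
    using ij by (subst sum.swap) (simp add: mult_index_sum[OF H trace_first_carrier] index_trace_first sum_distrib_left)
  finally show "trace_first d m (kron (1\<^sub>m d) H * A) $$ (i, j) = (H * trace_first d m A) $$ (i, j)" .
qed (use H in \<open>auto simp: trace_first_def\<close>)

lemma trace_first_mult_right:
  assumes H: "H \<in> carrier_mat m m" and A: "A \<in> carrier_mat (d * m) (d * m)"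
  shows "trace_first d m (A * kron (1\<^sub>m d) H) = trace_first d m A * H"
proof (rule eq_matI)
  fix i j
  assume "i < dim_row (trace_first d m A * H)" "j < dim_col (trace_first d m A * H)"
  then have ij: "i < m" "j < m" using H by (simp_all add: trace_first_def)
  have K: "kron (1\<^sub>m d) H \<in> carrier_mat (d * m) (d * m)" using H by simp
  have "trace_first d m (A * kron (1\<^sub>m d) H) $$ (i, j) = (\<Sum>k<d. \<Sum>k'<d. \<Sum>l<m. (if k = k' then A $$ (k * m + i, k * m + l) * H $$ (l, j) else 0))"
    using ij by (auto simp: index_trace_first mult_index_sum[OF A K] pair_less sum_lessThan_mult'
        index_kron_pair[OF one_carrier_mat H] intro!: sum.cong)
  also have "\<dots> = (\<Sum>k<d. \<Sum>l<m. A $$ (k * m + i, k * m + l) * H $$ (l, j))"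
    by (subst sum.swap) (simp add: sum.swap[of _ "{..<m}"] if_distrib cong: if_cong)
  also have "\<dots> = (trace_first d m A * H) $$ (i, j)"
    using ij by (subst sum.swap) (simp add: mult_index_sum[OF trace_first_carrier H] index_trace_first sum_distrib_right)
  finally show "trace_first d m (A * kron (1\<^sub>m d) H) $$ (i, j) = (trace_first d m A * H) $$ (i, j)" .
qed (use H in \<open>auto simp: trace_first_def\<close>)

text \<open>A partial trace is not cyclic in general. It is cyclic for operators on the traced
  factor alone, whose entries are scalars multiplying the blocks of \<open>A\<close>.\<close>

lemma trace_first_cyclic:
  assumes Z: "Z \<in> carrier_mat d d" and A: "A \<in> carrier_mat (d * m) (d * m)"
  shows "trace_first d m (kron Z (1\<^sub>m m) * A) = trace_first d m (A * kron Z (1\<^sub>m m))"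
proof (rule eq_matI)
  fix i j
  assume "i < dim_row (trace_first d m (A * kron Z (1\<^sub>m m)))" "j < dim_col (trace_first d m (A * kron Z (1\<^sub>m m)))"
  then have ij: "i < m" "j < m" by (simp_all add: trace_first_def)
  have K: "kron Z (1\<^sub>m m) \<in> carrier_mat (d * m) (d * m)" using Z by simp
  have "trace_first d m (kron Z (1\<^sub>m m) * A) $$ (i, j)
      = (\<Sum>k<d. \<Sum>k'<d. \<Sum>l<m. (if l = i then Z $$ (k, k') * A $$ (k' * m + l, k * m + j) else 0))"
    using ij by (auto simp: index_trace_first mult_index_sum[OF K A] pair_less sum_lessThan_mult'
        index_kron_pair[OF Z one_carrier_mat] simp del: sum.delta sum.delta' intro!: sum.cong)
  also have "\<dots> = (\<Sum>k<d. \<Sum>k'<d. Z $$ (k, k') * A $$ (k' * m + i, k * m + j))"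
    using ij by simp
  also have "\<dots> = (\<Sum>k'<d. \<Sum>k<d. Z $$ (k, k') * A $$ (k' * m + i, k * m + j))"
    by (rule sum.swap)
  \<comment> \<open>The identity on the second leg is reinserted, now on the column side, and
    \<open>k'\<close> has become the index of the trace.\<close>
  also have "\<dots> = (\<Sum>k'<d. \<Sum>k<d. \<Sum>l<m. (if l = j then A $$ (k' * m + i, k * m + l) * Z $$ (k, k') else 0))"
    using ij by (simp add: mult.commute)
  also have "\<dots> = trace_first d m (A * kron Z (1\<^sub>m m)) $$ (i, j)"
    using ij by (auto simp: index_trace_first mult_index_sum[OF A K] pair_less sum_lessThan_mult'
        index_kron_pair[OF Z one_carrier_mat] simp del: sum.delta sum.delta' intro!: sum.cong)
  finally show "trace_first d m (kron Z (1\<^sub>m m) * A) $$ (i, j) = trace_first d m (A * kron Z (1\<^sub>m m)) $$ (i, j)" .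
qed (auto simp: trace_first_def)

text \<open>As \<open>Z\<close> squares to one, \<open>H\<close> on the second leg equals
  \<open>kron Z (1\<^sub>m m) * kron Z H\<close>. The second factor passes through \<open>A\<close>
  by hypothesis, the first moves to the far right by cyclicity, and there the two recombine.\<close>

lemma trace_first_commute:
  assumes Z: "Z \<in> carrier_mat d d" "Z * Z = 1\<^sub>m d" and H: "H \<in> carrier_mat m m"
    and A: "A \<in> carrier_mat (d * m) (d * m)" and comm: "kron Z H * A = A * kron Z H"
  shows "H * trace_first d m A = trace_first d m A * H"
proof -
  have K: "kron Z H \<in> carrier_mat (d * m) (d * m)" "kron Z (1\<^sub>m m) \<in> carrier_mat (d * m) (d * m)"
    using Z H by simp_all
  have ZH: "kron Z (1\<^sub>m m) * kron Z H = kron (1\<^sub>m d) H" "kron Z H * kron Z (1\<^sub>m m) = kron (1\<^sub>m d) H"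
    using Z H by (simp_all add: kron_mult)
  have "H * trace_first d m A = trace_first d m (kron Z (1\<^sub>m m) * kron Z H * A)"
    by (simp add: ZH trace_first_mult_left[OF H A])
  also have "\<dots> = trace_first d m (kron Z (1\<^sub>m m) * (A * kron Z H))"
    using assoc_mult_mat[OF K(2) K(1) A] comm by simp
  also have "\<dots> = trace_first d m (A * kron Z H * kron Z (1\<^sub>m m))"
    by (rule trace_first_cyclic[OF Z(1)]) (rule mult_carrier_mat[OF A K(1)])
  also have "\<dots> = trace_first d m (A * kron (1\<^sub>m d) H)"
    using assoc_mult_mat[OF A K] ZH by simp
  finally show ?thesis by (simp add: trace_first_mult_right[OF H A])
qed

section \<open>The transfer matrix\<close>

lemma on2_carrier: "on2 d L k l X \<in> carrier_mat (d ^ L) (d ^ L)"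
  by (simp add: on2_def)

lemma Z_left_total_eq: "n \<ge> 1 \<Longrightarrow> Z_left_total n N = kron_pow (Z_left n) N"
  unfolding Z_left_total_def by (rule mprod_on1_eq_kron_pow[OF Z_left_carrier])

lemma T_mat_carrier: "T_mat n \<eta> N u \<in> carrier_mat ((2 * n) ^ (N + 1)) ((2 * n) ^ (N + 1))"
  unfolding T_mat_def R_ak_def by (rule mprod_carrier) (auto simp only: set_map intro: on2_carrier)

lemma T_hat_carrier: "T_hat n \<eta> N u \<in> carrier_mat ((2 * n) ^ (N + 1)) ((2 * n) ^ (N + 1))"
  unfolding T_hat_def R_ka_def by (rule mprod_carrier) (auto simp only: set_map intro: on2_carrier)

lemma T_mat_commute:
  assumes n: "n \<ge> 1"
  shows "kron_pow (Z_left n) (N + 1) * T_mat n \<eta> N u = T_mat n \<eta> N u * kron_pow (Z_left n) (N + 1)"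
  unfolding T_mat_def
proof (rule mprod_commute[OF kron_pow_carrier[OF Z_left_carrier[OF n]]])
  fix A assume "A \<in> set (map (\<lambda>k. R_ak n \<eta> N k u) (rev [1..<N + 1]))"
  then obtain k where k: "k < N + 1" "A = R_ak n \<eta> N k u" by (auto simp del: upt_Suc)
  show "A \<in> carrier_mat ((2 * n) ^ (N + 1)) ((2 * n) ^ (N + 1)) \<and>
      kron_pow (Z_left n) (N + 1) * A = A * kron_pow (Z_left n) (N + 1)"
    unfolding k(2) R_ak_def
    by (intro conjI on2_carrier kron_pow_on2_commute[OF n _ k(1) R_mat_carrier R_mat_commute[OF n]]) simp
qed

lemma T_hat_commute:
  assumes n: "n \<ge> 1"
  shows "kron_pow (Z_left n) (N + 1) * T_hat n \<eta> N u = T_hat n \<eta> N u * kron_pow (Z_left n) (N + 1)"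
  unfolding T_hat_def
proof (rule mprod_commute[OF kron_pow_carrier[OF Z_left_carrier[OF n]]])
  fix A assume "A \<in> set (map (\<lambda>k. R_ka n \<eta> N k u) [1..<N + 1])"
  then obtain k where k: "k < N + 1" "A = R_ka n \<eta> N k u" by (auto simp del: upt_Suc)
  have P: "perm_mat (2 * n) \<in> carrier_mat (2 * n * (2 * n)) (2 * n * (2 * n))"
    by (simp add: perm_mat_def)
  note PR = mult_carrier_mat[OF P R_mat_carrier]
  show "A \<in> carrier_mat ((2 * n) ^ (N + 1)) ((2 * n) ^ (N + 1)) \<and>
      kron_pow (Z_left n) (N + 1) * A = A * kron_pow (Z_left n) (N + 1)"
    unfolding k(2) R_ka_def
    by (intro conjI on2_carrier kron_pow_on2_commute[OF n _ k(1)] mult_carrier_mat[OF PR P]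
        commute_mult[OF kron_Z_left_carrier[OF n]] PR P R_mat_carrier R_mat_commute[OF n] perm_mat_commute[OF n]) simp
qed

theorem proposition7:
  fixes n p N :: nat and \<eta> \<gamma>0 :: complex
  assumes "n \<ge> 1" and "p < n" and "N \<ge> 1" and "\<gamma>0 \<in> {1, - 1}"
  shows "(\<forall>u. K_regular n \<eta> \<gamma>0 p u \<longrightarrow>
            Z_left_total n N * transfer_mat n \<eta> \<gamma>0 N p u
            - transfer_mat n \<eta> \<gamma>0 N p u * Z_left_total n N = 0\<^sub>m ((2 * n) ^ N) ((2 * n) ^ N))
         \<and> Z_left_total n N * Z_left_total n N = 1\<^sub>m ((2 * n) ^ N)"
proof (intro conjI allI impI)
  note n = assms(1)
  note Z = Z_left_carrier[OF n]
  let ?G = "kron_pow (Z_left n) (N + 1)"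
  have G: "?G \<in> carrier_mat ((2 * n) ^ (N + 1)) ((2 * n) ^ (N + 1))"
    by (rule kron_pow_carrier[OF Z])
  fix u
  let ?KL = "on1 (2 * n) (N + 1) 0 (KL n \<eta> \<gamma>0 p u)" and ?KR = "on1 (2 * n) (N + 1) 0 (KR n \<eta> \<gamma>0 p u)"
  let ?A = "?KL * T_mat n \<eta> N u * ?KR * T_hat n \<eta> N u"
  have KL: "?KL \<in> carrier_mat ((2 * n) ^ (N + 1)) ((2 * n) ^ (N + 1))" "?G * ?KL = ?KL * ?G"
    by (rule on1_carrier, simp, simp) (rule kron_pow_on1_intertwine[OF _ Z KL_carrier KL_carrier KL_commute[OF assms(2)]], simp)
  have KR: "?KR \<in> carrier_mat ((2 * n) ^ (N + 1)) ((2 * n) ^ (N + 1))" "?G * ?KR = ?KR * ?G"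
    by (rule on1_carrier, simp, simp) (rule kron_pow_on1_intertwine[OF _ Z KR_carrier KR_carrier KR_commute[OF assms(2)]], simp)
  note T = T_mat_carrier[of n \<eta> N u] T_hat_carrier[of n \<eta> N u]
  note LT = mult_carrier_mat[OF KL(1) T(1)]
  note LTR = mult_carrier_mat[OF LT KR(1)]
  have "?G * ?A = ?A * ?G"
    by (intro commute_mult[OF G] LTR LT KL KR T T_mat_commute[OF n] T_hat_commute[OF n])
  \<comment> \<open>The dimension is written with the auxiliary factor split off on the left;
    likewise \<open>?G\<close> becomes \<open>kron\<close> of one \<open>Z_left n\<close> and its
    \<open>N\<close>-th tensor power.\<close>
  moreover have "?A \<in> carrier_mat (2 * n * (2 * n) ^ N) (2 * n * (2 * n) ^ N)"
    using mult_carrier_mat[OF LTR T(2)] by simp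
  ultimately have "kron_pow (Z_left n) N * transfer_mat n \<eta> \<gamma>0 N p u = transfer_mat n \<eta> \<gamma>0 N p u * kron_pow (Z_left n) N"
    unfolding transfer_mat_def
    by (intro trace_first_commute[OF Z Z_left_involution[OF n] kron_pow_carrier[OF Z]])
       (simp_all only: kron_pow_Suc_left[symmetric] Suc_eq_plus1)
  then show "Z_left_total n N * transfer_mat n \<eta> \<gamma>0 N p u
            - transfer_mat n \<eta> \<gamma>0 N p u * Z_left_total n N = 0\<^sub>m ((2 * n) ^ N) ((2 * n) ^ N)"
    unfolding Z_left_total_eq[OF n] transfer_mat_def
    by (simp only: minus_r_inv_mat[OF mult_carrier_mat[OF trace_first_carrier kron_pow_carrier[OF Z]]])
next
  show "Z_left_total n N * Z_left_total n N = 1\<^sub>m ((2 * n) ^ N)"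
    unfolding Z_left_total_eq[OF assms(1)]
    by (rule kron_pow_involution[OF Z_left_carrier Z_left_involution]) (rule assms(1))+
qed

end
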